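(* Let $0<x<\pi/4$ and suppose that $(x,x)\neq V_n=(\pi/2n,\pi/2n)$ for every integer $n\ge 3$. Then there is a word $W$ in the letters $1,2,3$ such that the point $(x,x)$ lies in the interior of the orbit tile $O(W)$.
   Context: The parameter space of obtuse triangles is the open triangle $\Delta=\{(x_1,x_2)\in\mathbb{R}^2: x_1>0,\ x_2>0,\ x_1+x_2<\pi/2\}$; the point $(x_1,x_2)$ represents the obtuse triangle (up to similarity) whose two small angles are $x_1$ and $x_2$ radians. The sides of this triangle are labelled $1,2,3$, where side $j$ is opposite the angle $x_j$ for $j=1,2$, and side $3$ is the longest side. The obtuse isosceles line is the segment $\{(x,x):0<x<\pi/4\}$. A periodic billiard path in a triangle (unit speed motion, equal-angle reflections off the interiors of the sides, never hitting a vertex, closing up) has as its combinatorial type the periodic sequence of labels of the successive sides it hits. A finite word $W$ in $\{1,2,3\}$ is identified with the infinite periodic word obtained by repeating $W$. The orbit tile $O(W)\subset\Delta$ is the set of points whose corresponding triangle has a periodic billiard path of combinatorial type $W$. Interior means interior as a subset of $\mathbb{R}^2$. *)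

theory Defs
  imports "HOL-Analysis.Analysis"
begin

definition obtuse_triangles :: "(real \<times> real) set" where
  "obtuse_triangles = {(x1, x2). x1 > 0 \<and> x2 > 0 \<and> x1 + x2 < pi / 2}"

(* The triangle of a parameter point, normalised so that every side has length equal to the sine
   of the opposite angle (law of sines). Vertex j, for j = 1, 2, has angle x_j; the remaining
   vertex has the obtuse angle pi - x1 - x2. *)
definition vertex :: "real \<times> real \<Rightarrow> nat \<Rightarrow> complex" where
  "vertex = (\<lambda>(x1, x2) j.
     if j = 1 then 0
     else if j = 2 then complex_of_real (sin (x1 + x2))
     else complex_of_real (sin x2) * cis x1)"

(* Side j is opposite vertex j. Only the labels 1, 2, 3 are meaningful. *)
definition side_ends :: "real \<times> real \<Rightarrow> nat \<Rightarrow> complex \<times> complex" where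
  "side_ends z j =
     (if j = 1 then (vertex z 2, vertex z 3)
      else if j = 2 then (vertex z 3, vertex z 1)
      else (vertex z 1, vertex z 2))"

definition open_side :: "real \<times> real \<Rightarrow> nat \<Rightarrow> complex set" where
  "open_side z j = open_segment (fst (side_ends z j)) (snd (side_ends z j))"

definition side_direction :: "real \<times> real \<Rightarrow> nat \<Rightarrow> complex" where
  "side_direction z j = snd (side_ends z j) - fst (side_ends z j)"

(* Orthogonal reflection of the vector v in the line spanned by d. *)
definition mirror :: "complex \<Rightarrow> complex \<Rightarrow> complex" where
  "mirror d v = (2 * (v \<bullet> d) / (d \<bullet> d)) *\<^sub>R d - v"

(* A billiard path is given by its successive bounce points p 0, p 1, ... and the labels
   s 0, s 1, ... of the sides hit there; between bounces it runs along straight segments.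
   By convexity, consecutive bounces on different sides make each segment cross the open triangle,
   so no further hits occur. sgn of a displacement is the unit velocity, and the last conjunct
   is the equal-angle law at the bounce point p (k + 1). *)
definition billiard_path :: "real \<times> real \<Rightarrow> (nat \<Rightarrow> nat) \<Rightarrow> (nat \<Rightarrow> complex) \<Rightarrow> bool" where
  "billiard_path z s p \<longleftrightarrow>
     (\<forall>k. p k \<in> open_side z (s k)) \<and>
     (\<forall>k. s (k + 1) \<noteq> s k) \<and>
     (\<forall>k. sgn (p (k + 2) - p (k + 1)) =
           mirror (side_direction z (s (k + 1))) (sgn (p (k + 1) - p k)))"

(* Closing up after m bounces: since all later bounce points recur, the velocities recur too. *)
definition periodic_billiard_path :: "real \<times> real \<Rightarrow> (nat \<Rightarrow> nat) \<Rightarrow> (nat \<Rightarrow> complex) \<Rightarrow> bool" where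
  "periodic_billiard_path z s p \<longleftrightarrow>
     billiard_path z s p \<and> (\<exists>m>0. \<forall>k. p (k + m) = p k)"

definition periodic_word :: "nat list \<Rightarrow> nat \<Rightarrow> nat" where
  "periodic_word W k = W ! (k mod length W)"

(* The number of bounces after which the path closes up need not be length W: the type is the
   infinite word, so for odd length W a path may close up only after two repetitions of W. *)
definition orbit_tile :: "nat list \<Rightarrow> (real \<times> real) set" where
  "orbit_tile W =
     {z \<in> obtuse_triangles. \<exists>p. periodic_billiard_path z (periodic_word W) p}"

definition V :: "nat \<Rightarrow> real \<times> real" where
  "V n = (pi / (2 * real n), pi / (2 * real n))"

end

theory Submission
  imports Defs
begin

text \<open>The word is chosen so that, unfolded along the path, the triangle turns alternately about its two
acute corners. Choose \<open>n \<ge> 2\<close> with \<open>2nx < \<pi> < 2(n+1)x\<close>; since \<open>x < \<pi>/4\<close> and \<open>(x, x)\<close> is no \<open>V n\<close>,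
such an \<open>n\<close> exists. Write \<open>s\<^sub>j = sin 2jx\<close>, let the base (side 3) have length \<open>\<ell> = sin 2x\<close>, and
start along a horizontal line at height \<open>y\<close> above the base, going from side 1 to side 2. While a path alternates
between sides 2 and 3 its distance \<open>\<rho>\<close> to vertex 1 does not change, and each return to the base
raises its angle there from \<open>2jx\<close> to \<open>2(j+1)x\<close>. At the angle \<open>2nx\<close> the path is left to alternate
between sides 1 and 3, now keeping its distance \<open>\<ell>s\<^sub>n - \<rho>\<close> to vertex 2, and its angle falls back to
\<open>2x\<close>. Such a pair of fans increases \<open>\<rho>\<close> by \<open>\<delta> = \<ell>(s\<^sub>1 - s\<^sub>n) > 0\<close>. After \<open>k + 1\<close> pairs the path
bounces off side 1 into the same horizontal line, provided \<open>2y + k\<delta> = \<ell>s\<^sub>n\<close>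
(\<open>orbit_word_closed_line\<close>, where \<open>m = n - 1\<close>).

The path avoids the vertices if \<open>y\<close> satisfies three inequalities. With
\<open>\<beta> = \<pi> - 2nx \<in> (0, 2x)\<close> and \<open>D = sin 2x - sin \<beta>\<close> they say
\<open>sin \<beta> - tan x < kD < min (sin \<beta>) (cos \<beta> tan x)\<close>.
If the left end is negative, \<open>k = 0\<close> works. Otherwise the interval is longer than \<open>D\<close> and so contains a
multiple of \<open>D\<close>: this amounts to \<open>cos 2x < 1\<close> and \<open>cos 2x < cos \<beta>\<close>
(\<open>exists_repetition_number\<close>).

The word has odd length, and this makes the path persist under any small change of the triangle
(\<open>odd_closed_line_stable\<close>). The composition of an odd number of reflections is orientation
reversing, so for every triangle there is a line that it carries to itself, the axis of a glide
reflection. This line depends continuously on the triangle, and to cross the prescribed sides in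
their interiors is an open condition.\<close>

section \<open>Oriented lines and their reflections\<close>

text \<open>An oriented line is stored as its unit direction \<open>u\<close> and the common moment \<open>c\<close> of its points \<open>q\<close>, the
cross product of \<open>u\<close> and \<open>q\<close>. Points to the left of the line have larger moment, points to
the right smaller moment.\<close>

definition moment :: "complex \<Rightarrow> complex \<Rightarrow> real" where
  "moment u q = Im (cnj u * q)"

text \<open>The reflection of an oriented line in the line through a side. Reflection reverses signed
distances to a point of the mirror, so \<open>c' - moment u' a = moment u a - c\<close> for the end \<open>a\<close> of the side.\<close>

definition bounce :: "real \<times> real \<Rightarrow> nat \<Rightarrow> complex \<times> real \<Rightarrow> complex \<times> real" where
  "bounce z j = (\<lambda>(u, c).
     let u' = mirror (side_direction z j) u; a = fst (side_ends z j)
     in (u', moment u a + moment u' a - c))"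

text \<open>The sides run counterclockwise around the triangle. So if the first end of a side lies to the
left of a line and the second end to the right, then the line crosses the open side into the triangle.\<close>

definition leaves :: "real \<times> real \<Rightarrow> nat \<Rightarrow> complex \<times> real \<Rightarrow> bool" where
  "leaves z j = (\<lambda>(u, c).
     moment u (snd (side_ends z j)) < c \<and> c < moment u (fst (side_ends z j)))"

fun hits :: "real \<times> real \<Rightarrow> nat list \<Rightarrow> complex \<times> real \<Rightarrow> bool" where
  "hits z [] l \<longleftrightarrow> True"
| "hits z (j # w) l \<longleftrightarrow> leaves z j (bounce z j l) \<and> hits z w (bounce z j l)"

definition foot :: "real \<times> real \<Rightarrow> nat \<Rightarrow> complex \<times> real \<Rightarrow> complex" where
  "foot z j = (\<lambda>(u, c).
     let a = fst (side_ends z j); b = snd (side_ends z j)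
     in a + of_real ((moment u a - c) / (moment u a - moment u b)) * (b - a))"

lemma moment_simps:
  "moment u (p + q) = moment u p + moment u q"
  "moment u (p - q) = moment u p - moment u q"
  "moment u (of_real t * q) = t * moment u q"
  by (simp_all add: moment_def algebra_simps)

lemma bounce_Pair:
  "bounce z j (u, c) = (mirror (side_direction z j) u,
     moment u (fst (side_ends z j)) + moment (mirror (side_direction z j) u) (fst (side_ends z j)) - c)"
  by (simp add: bounce_def Let_def)

lemma unit_times_cnj: "norm u = 1 \<Longrightarrow> u * cnj u = 1"
  using complex_norm_square[of u] by simp

lemma hits_append:
  "hits z (v @ w) l \<longleftrightarrow> hits z v l \<and> hits z w (fold (bounce z) v l)"
  by (induction v arbitrary: l) auto

lemma hits_nth:
  assumes "hits z w l" "k < length w"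
  shows "leaves z (w ! k) (fold (bounce z) (take (Suc k) w) l)"
  using assms
proof (induction w arbitrary: l k)
  case (Cons j w)
  then show ?case by (cases k) auto
qed simp

lemma mirror_eq_cnj:
  assumes "d \<noteq> 0"
  shows "mirror d u = (sgn d)\<^sup>2 * cnj u"
proof -
  have n: "d \<bullet> d = (cmod d)\<^sup>2" by (simp add: power2_norm_eq_inner)
  have n0: "(cmod d)\<^sup>2 \<noteq> 0" using assms by simp
  have "of_real ((cmod d)\<^sup>2) * mirror d u = of_real ((cmod d)\<^sup>2) * ((sgn d)\<^sup>2 * cnj u)"
  proof -
    have "of_real ((cmod d)\<^sup>2) * mirror d u
        = of_real (2 * (u \<bullet> d)) * d - of_real (d \<bullet> d) * u"
      unfolding mirror_def scaleR_conv_of_real n using n0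
      by (simp add: right_diff_distrib flip: of_real_mult)
    also have "\<dots> = d\<^sup>2 * cnj u"
      by (simp add: complex_eq_iff inner_complex_def power2_eq_square algebra_simps)
    also have "\<dots> = of_real ((cmod d)\<^sup>2) * ((sgn d)\<^sup>2 * cnj u)"
      using assms by (simp add: sgn_eq power_divide)
    finally show ?thesis .
  qed
  then show ?thesis using n0 by (metis mult_left_cancel of_real_eq_0_iff)
qed

lemma moment_mirror:
  assumes "d \<noteq> 0"
  shows "moment (mirror d u) d = - moment u d"
proof -
  have "sgn d * cnj (sgn d) = 1"
    using assms by (intro unit_times_cnj) (simp add: norm_sgn)
  have "d = of_real (cmod d) * sgn d" using assms by (simp add: sgn_eq)
  then have "cnj (mirror d u) * d = of_real (cmod d) * (cnj (sgn d) * u * (sgn d * cnj (sgn d)))"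
    using mirror_eq_cnj[OF assms, of u]
    by (metis (no_types, lifting) complex_cnj_cnj complex_cnj_mult complex_cnj_power mult.assoc mult.commute power2_eq_square)
  also have "\<dots> = cnj d * u"
    using \<open>d = of_real (cmod d) * sgn d\<close> \<open>sgn d * cnj (sgn d) = 1\<close>
    by (metis complex_cnj_complex_of_real complex_cnj_mult mult.assoc mult.right_neutral)
  finally show ?thesis by (simp add: moment_def)
qed

lemma norm_mirror: "d \<noteq> 0 \<Longrightarrow> norm (mirror d u) = norm u"
  by (simp add: mirror_eq_cnj norm_mult norm_power norm_sgn)

lemma sides:
  "side_ends z (Suc 0) = (vertex z 2, vertex z 3)"
  "side_ends z 2 = (vertex z 3, vertex z 1)"
  "side_ends z 3 = (vertex z 1, vertex z 2)"
  by (simp_all add: side_ends_def)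

lemma triangle_oriented:
  assumes "z \<in> obtuse_triangles"
  shows "moment (vertex z 2 - vertex z 1) (vertex z 3 - vertex z 1) > 0"
proof -
  obtain a b where z: "z = (a, b)" "a > 0" "b > 0" "a + b < pi / 2"
    using assms by (auto simp: obtuse_triangles_def)
  then have "sin a > 0" "sin b > 0" "sin (a + b) > 0"
    by (auto intro!: sin_gt_zero)
  then show ?thesis
    by (simp add: z vertex_def moment_def)
qed

text \<open>Every point of another open side lies strictly on the inner side of side \<open>j\<close>. This fixes the sign
of the displacement between consecutive bounces.\<close>

lemma side_oriented:
  assumes "z \<in> obtuse_triangles" "i \<in> {1, 2, 3}" "j \<in> {1, 2, 3}" "i \<noteq> j" "q \<in> open_side z i"
  shows "moment (side_direction z j) (q - fst (side_ends z j)) > 0"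
proof -
  note pos = triangle_oriented[OF assms(1)]
  obtain t where t: "0 < t" "t < 1"
    "q = fst (side_ends z i) + of_real t * (snd (side_ends z i) - fst (side_ends z i))"
    using assms(5) unfolding open_side_def in_segment
    by (auto simp: scaleR_conv_of_real algebra_simps)
  define a where "a = moment (vertex z 2 - vertex z 1) (vertex z 3 - vertex z 1)"
  have "moment (side_direction z j) (q - fst (side_ends z j)) = t * a
      \<or> moment (side_direction z j) (q - fst (side_ends z j)) = (1 - t) * a"
    using assms(2-4) unfolding t(3) a_def
    by (auto simp: sides side_direction_def moment_def) (algebra | simp add: algebra_simps)+
  then show ?thesis using t pos a_def by auto
qed

section \<open>A closed line gives a periodic path\<close>

lemma side_direction_nonzero_if_leaves:
  assumes "leaves z j l"
  shows "side_direction z j \<noteq> 0"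
  using assms by (auto simp: leaves_def side_direction_def split: prod.splits)

lemma foot_in_open_side:
  assumes "leaves z j l"
  shows "foot z j l \<in> open_side z j"
proof -
  obtain u c where l: "l = (u, c)" by fastforce
  let ?a = "fst (side_ends z j)" and ?b = "snd (side_ends z j)"
  have m: "moment u ?b < c" "c < moment u ?a" using assms by (auto simp: l leaves_def)
  define t where "t = (moment u ?a - c) / (moment u ?a - moment u ?b)"
  have "0 < t" "t < 1" using m by (auto simp: t_def field_simps)
  moreover have "foot z j l = (1 - t) *\<^sub>R ?a + t *\<^sub>R ?b"
    unfolding foot_def l Let_def prod.case t_def[symmetric]
    by (simp add: scaleR_conv_of_real algebra_simps)
  moreover have "?a \<noteq> ?b" using m by auto
  ultimately show ?thesis unfolding open_side_def in_segment by blast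
qed

lemma foot_on_side:
  "\<exists>t. foot z j l = fst (side_ends z j) + of_real t * side_direction z j"
  unfolding foot_def side_direction_def Let_def case_prod_unfold by blast

lemma moment_foot:
  assumes "leaves z j (u, c)"
  shows "moment u (foot z j (u, c)) = c"
  using assms unfolding foot_def Let_def prod.case moment_simps
  by (simp add: leaves_def field_simps)

text \<open>The incoming and the outgoing line of a bounce meet the side at the same point, because reflection
fixes the mirror pointwise.\<close>

lemma moment_foot_incoming:
  assumes "leaves z j (bounce z j (u, c))"
  shows "moment u (foot z j (bounce z j (u, c))) = c"
proof -
  define u' where "u' = mirror (side_direction z j) u"
  let ?a = "fst (side_ends z j)"
  have b: "bounce z j (u, c) = (u', moment u ?a + moment u' ?a - c)"
    by (simp add: bounce_Pair u'_def)
  obtain t where t: "foot z j (bounce z j (u, c)) = ?a + of_real t * side_direction z j"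
    using foot_on_side by blast
  have "moment u' (foot z j (bounce z j (u, c))) = moment u ?a + moment u' ?a - c"
    using moment_foot assms unfolding b by blast
  moreover have "moment u' (side_direction z j) = - moment u (side_direction z j)"
    unfolding u'_def by (rule moment_mirror[OF side_direction_nonzero_if_leaves[OF assms]])
  ultimately show ?thesis unfolding t by (simp add: moment_simps)
qed

text \<open>Reflection exchanges the two sides of the line, so before the bounce the ends of the side are seen in
the opposite order: the line crosses the side out of the triangle.\<close>

lemma arrives:
  assumes "leaves z j (bounce z j (u, c))"
  shows "moment u (fst (side_ends z j)) < c \<and> c < moment u (snd (side_ends z j))"
proof -
  have "moment (mirror (side_direction z j) u) (side_direction z j) = - moment u (side_direction z j)"
    by (rule moment_mirror[OF side_direction_nonzero_if_leaves[OF assms]])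
  then show ?thesis
    using assms by (simp add: leaves_def bounce_def Let_def side_direction_def moment_simps)
qed

lemma parallel_to_unit:
  assumes "norm u = 1" "moment u v = 0"
  shows "v = of_real (u \<bullet> v) * u"
proof -
  have "cnj u * v = of_real (u \<bullet> v)"
    using assms(2) by (simp add: complex_eq_iff moment_def inner_complex_def)
  then have "(u * cnj u) * v = of_real (u \<bullet> v) * u" by (simp add: mult_ac)
  then show ?thesis using unit_times_cnj[OF assms(1)] by simp
qed

text \<open>Consecutive lines cannot cross the same side, since one crosses into the triangle and the next one
out of it. For different sides, the displacement between the bounce points is a multiple of \<open>u\<close>; the
factor is positive because the first point lies inside the half-plane that \<open>u\<close> leaves at the second.\<close>

lemma sgn_chord:
  assumes "z \<in> obtuse_triangles" "i \<in> {1, 2, 3}" "j \<in> {1, 2, 3}"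
    and u: "norm u = 1" and i: "leaves z i (u, c)" and j: "leaves z j (bounce z j (u, c))"
  shows "i \<noteq> j"
    and "sgn (foot z j (bounce z j (u, c)) - foot z i (u, c)) = u"
proof -
  show ij: "i \<noteq> j"
    using i arrives[OF j] by (auto simp: leaves_def)
  let ?p = "foot z i (u, c)" and ?q = "foot z j (bounce z j (u, c))"
  let ?d = "side_direction z j"
  define r where "r = u \<bullet> (?q - ?p)"
  have "moment u (?q - ?p) = 0"
    using moment_foot[OF i] moment_foot_incoming[OF j] by (simp add: moment_simps)
  then have chord: "?q - ?p = of_real r * u"
    unfolding r_def by (rule parallel_to_unit[OF u])
  have "moment ?d (?p - fst (side_ends z j)) > 0"
    using side_oriented[OF assms(1-3) ij foot_in_open_side[OF i]] .
  moreover have "moment ?d (?q - fst (side_ends z j)) = 0"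
    using foot_on_side[of z j "bounce z j (u, c)"] by (auto simp: moment_def)
  ultimately have "moment ?d (?q - ?p) < 0" by (simp add: moment_simps)
  then have "r * moment ?d u < 0" unfolding chord by (simp add: moment_simps)
  moreover have "moment ?d u = - moment u ?d" by (simp add: moment_def)
  moreover have "moment u ?d > 0"
    using arrives[OF j] by (simp add: side_direction_def moment_simps)
  ultimately have "r > 0" by (simp add: zero_less_mult_iff)
  then show "sgn (?q - ?p) = u"
    unfolding chord using u by (simp add: sgn_eq norm_mult)
qed

lemma norm_bounce:
  assumes "leaves z j (bounce z j l)"
  shows "norm (fst (bounce z j l)) = norm (fst l)"
  using norm_mirror[OF side_direction_nonzero_if_leaves[OF assms]]
  by (simp add: bounce_def Let_def split: prod.splits)

text \<open>The bounce points of a line that closes up after one reading of the word, repeated with period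
\<open>length W\<close>, form a billiard path: the reflection law is built into the directions of the lines.\<close>

theorem closed_line_in_orbit_tile:
  assumes z: "z \<in> obtuse_triangles" and W: "W \<noteq> []" "set W \<subseteq> {1, 2, 3}"
    and u: "norm (fst l) = 1" and closed: "fold (bounce z) W l = l" and hits: "hits z W l"
  shows "z \<in> orbit_tile W"
proof -
  define m where "m = length W"
  have m: "m > 0" using W by (simp add: m_def)
  define s where "s = periodic_word W"
  define L where "L k = fold (bounce z) (take (k mod m) W) l" for k
  have s: "s k = W ! (k mod m)" for k by (simp add: s_def periodic_word_def m_def)
  have step': "L (Suc k) = fold (bounce z) (take (Suc (k mod m)) W) l" for k
  proof (cases "Suc (k mod m) = m")
    case True
    then have "Suc k mod m = 0" by (simp add: mod_Suc)
    then show ?thesis using closed True by (simp add: L_def m_def)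
  next
    case False
    then show ?thesis by (simp add: L_def mod_Suc)
  qed
  have step: "L (Suc k) = bounce z (s k) (L k)" for k
  proof -
    have "take (Suc (k mod m)) W = take (k mod m) W @ [W ! (k mod m)]"
      using m by (intro take_Suc_conv_app_nth) (simp add: m_def)
    then show ?thesis unfolding step' by (simp add: s L_def)
  qed
  have leaves: "leaves z (s k) (L (Suc k))" for k
    unfolding step' s using hits_nth[OF hits] m by (simp add: m_def)
  have lab: "s k \<in> {1, 2, 3}" for k
  proof -
    have "W ! (k mod m) \<in> set W" using m by (simp add: m_def)
    then show ?thesis using W(2) unfolding s by blast
  qed
  have norm: "norm (fst (L k)) = 1" for k
  proof (induction k)
    case 0
    then show ?case by (simp add: L_def u)
  next
    case (Suc k)
    then show ?case using norm_bounce[of z "s k" "L k"] leaves[of k] by (simp add: step)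
  qed
  define p where "p k = foot z (s k) (L (Suc k))" for k
  have chord: "s k \<noteq> s (Suc k) \<and> sgn (p (Suc k) - p k) = fst (L (Suc k))" for k
  proof -
    obtain v c where v: "L (Suc k) = (v, c)" by fastforce
    show ?thesis
      using sgn_chord[OF z lab lab, of v k c "Suc k"] norm[of "Suc k"] leaves[of k] leaves[of "Suc k"]
      unfolding p_def step[of "Suc k"] by (simp add: v)
  qed
  have "billiard_path z s p"
    unfolding billiard_path_def
  proof (intro conjI allI)
    fix k
    show "p k \<in> open_side z (s k)"
      unfolding p_def by (rule foot_in_open_side[OF leaves])
    show "s (k + 1) \<noteq> s k" using chord[of k] by simp
    have "sgn (p (k + 2) - p (k + 1)) = fst (bounce z (s (Suc k)) (L (Suc k)))"
      using chord[of "Suc k"] step[of "Suc k"] by simp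
    also have "\<dots> = mirror (side_direction z (s (Suc k))) (fst (L (Suc k)))"
      by (simp add: bounce_def Let_def split: prod.splits)
    finally show "sgn (p (k + 2) - p (k + 1)) =
        mirror (side_direction z (s (k + 1))) (sgn (p (k + 1) - p k))"
      using chord[of k] by simp
  qed
  moreover have "p (k + m) = p k" for k
    using mod_Suc_eq[of "k + m" m] mod_Suc_eq[of k m] by (simp add: p_def s step')
  ultimately show ?thesis
    using z m by (auto simp: orbit_tile_def periodic_billiard_path_def s_def)
qed

section \<open>Odd words are stable\<close>

text \<open>Reading a word maps a direction \<open>u\<close> to \<open>g\<^sup>2 u\<close> or \<open>g\<^sup>2 cnj u\<close>, depending on the parity of the length. The
square root \<open>g\<close> matters since for odd length the fixed directions are exactly \<open>g\<close> and \<open>- g\<close>; this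
product of side directions selects a root that is continuous in the triangle.\<close>

fun rotation_root :: "real \<times> real \<Rightarrow> nat list \<Rightarrow> complex" where
  "rotation_root z [] = 1"
| "rotation_root z (j # w) = rotation_root z w *
     (if even (length w) then sgn (side_direction z j) else cnj (sgn (side_direction z j)))"

lemma fst_fold_bounce:
  assumes "\<And>j. side_direction z j \<noteq> 0"
  shows "fst (fold (bounce z) w (u, c)) = (rotation_root z w)\<^sup>2 * (if even (length w) then u else cnj u)"
  by (induction w arbitrary: u c)
    (auto simp: bounce_Pair mirror_eq_cnj assms power_mult_distrib)

text \<open>For odd length the moment enters with the factor \<open>- 1\<close>, so that a fixed moment exists and is half of
the value for \<open>c = 0\<close>.\<close>

lemma snd_fold_bounce:
  "snd (fold (bounce z) w (u, c)) = snd (fold (bounce z) w (u, 0)) + (- 1) ^ length w * c"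
proof (induction w arbitrary: u c)
  case (Cons j w)
  let ?u = "mirror (side_direction z j) u" and ?a = "fst (side_ends z j)"
  have *: "snd (fold (bounce z) (j # w) (u, c))
      = snd (fold (bounce z) w (?u, 0)) + (- 1) ^ length w * (moment u ?a + moment ?u ?a - c)" for c
    using Cons[of ?u "moment u ?a + moment ?u ?a - c"] by (simp add: bounce_Pair)
  show ?case unfolding *[of c] *[of 0] by (simp add: algebra_simps)
qed simp

lemma norm_rotation_root:
  assumes "\<And>j. side_direction z j \<noteq> 0"
  shows "norm (rotation_root z w) = 1"
  by (induction w) (simp_all add: norm_mult norm_sgn assms)

lemma side_direction_neq_0:
  assumes "z \<in> obtuse_triangles"
  shows "side_direction z j \<noteq> 0"
proof
  assume "side_direction z j = 0"
  moreover have "moment (vertex z 2 - vertex z 1) (vertex z 3 - vertex z 1) \<noteq> 0"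
    using triangle_oriented[OF assms] by simp
  ultimately show False
    by (auto simp: side_direction_def side_ends_def moment_def algebra_simps split: if_splits)
qed

lemma open_obtuse_triangles: "open obtuse_triangles"
proof -
  have "obtuse_triangles = {z. 0 < fst z} \<inter> {z. 0 < snd z} \<inter> {z. fst z + snd z < pi / 2}"
    by (auto simp: obtuse_triangles_def)
  also have "open \<dots>"
    by (intro open_Int open_Collect_less continuous_intros)
  finally show ?thesis .
qed

lemma isCont_vertex: "isCont (\<lambda>z. vertex z j) z"
  unfolding vertex_def case_prod_unfold cis_conv_exp
  by (cases "j = 1"; cases "j = 2") (auto intro!: continuous_intros)

lemma isCont_side:
  "isCont (\<lambda>z. fst (side_ends z j)) z" "isCont (\<lambda>z. snd (side_ends z j)) z"
  "isCont (\<lambda>z. side_direction z j) z"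
  unfolding side_direction_def
  by (cases "j = 1"; cases "j = 2"; simp add: side_ends_def isCont_vertex continuous_diff)+

lemma isCont_moment:
  "isCont f z \<Longrightarrow> isCont g z \<Longrightarrow> isCont (\<lambda>z. moment (f z) (g z)) z"
  unfolding moment_def isCont_def by (intro tendsto_intros)

lemma isCont_mirror:
  assumes "isCont d z" "isCont f z" "d z \<noteq> 0"
  shows "isCont (\<lambda>z. mirror (d z) (f z)) z"
proof -
  have "d \<midarrow>z\<rightarrow> d z" "f \<midarrow>z\<rightarrow> f z" using assms by (simp_all add: isCont_def)
  then show ?thesis
    unfolding mirror_def isCont_def by (intro tendsto_intros) (use assms in auto)
qed

lemma isCont_bounce:
  assumes "isCont f z" "side_direction z j \<noteq> 0"
  shows "isCont (\<lambda>z. bounce z j (f z)) z"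
proof -
  have f: "isCont (\<lambda>z. fst (f z)) z" "isCont (\<lambda>z. snd (f z)) z"
    using assms(1) by (simp_all add: continuous_fst continuous_snd)
  have m: "isCont (\<lambda>z. mirror (side_direction z j) (fst (f z))) z"
    by (rule isCont_mirror[OF isCont_side(3) f(1) assms(2)])
  show ?thesis
    unfolding bounce_def case_prod_unfold Let_def
    by (intro continuous_Pair continuous_add continuous_diff isCont_moment isCont_side f m)
qed

lemma isCont_fold_bounce:
  assumes "isCont f z" "\<And>j. side_direction z j \<noteq> 0"
  shows "isCont (\<lambda>z. fold (bounce z) w (f z)) z"
  using assms(1)
proof (induction w arbitrary: f)
  case (Cons j w)
  show ?case
    using Cons.IH[OF isCont_bounce[OF Cons.prems assms(2)]] by simp
qed simp

lemma isCont_rotation_root: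
  assumes "\<And>j. side_direction z j \<noteq> 0"
  shows "isCont (\<lambda>z. rotation_root z w) z"
proof (induction w)
  case (Cons j w)
  have "isCont (\<lambda>z. sgn (side_direction z j)) z"
    using assms isCont_side(3) by (intro continuous_intros)
  with Cons show ?case by (cases "even (length w)") (auto intro!: continuous_intros)
qed simp

lemma eventually_hits:
  assumes "isCont f z" "\<And>j. side_direction z j \<noteq> 0" "hits z w (f z)"
  shows "\<forall>\<^sub>F y in nhds z. hits y w (f y)"
  using assms(1,3)
proof (induction w arbitrary: f)
  case (Cons j w)
  let ?g = "\<lambda>y. bounce y j (f y)"
  have g: "isCont ?g z" using isCont_bounce Cons.prems(1) assms(2) by blast
  have ev: "\<forall>\<^sub>F y in nhds z. F y < G y" if "isCont F z" "isCont G z" "F z < G z"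
    for F G :: "real \<times> real \<Rightarrow> real"
  proof -
    have "(\<lambda>y. G y - F y) \<midarrow>z\<rightarrow> G z - F z"
      using that by (intro isContD continuous_intros)
    then have "\<forall>\<^sub>F y in at z. 0 < G y - F y"
      by (rule order_tendstoD(1)) (use that in simp)
    then show ?thesis using that(3) by (simp add: eventually_nhds_conv_at)
  qed
  have gc: "isCont (\<lambda>y. fst (?g y)) z" "isCont (\<lambda>y. snd (?g y)) z"
    using g by (simp_all add: continuous_fst continuous_snd)
  have "\<forall>\<^sub>F y in nhds z. leaves y j (?g y)"
    unfolding leaves_def case_prod_unfold
    by (intro eventually_conj ev isCont_moment isCont_side gc)
      (use Cons.prems(2) in \<open>auto simp: leaves_def case_prod_unfold\<close>)
  moreover have "\<forall>\<^sub>F y in nhds z. hits y w (?g y)"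
    using Cons.IH[OF g] Cons.prems(2) by simp
  ultimately show ?case by eventually_elim simp
qed simp

text \<open>For nearby triangles the fixed direction and the fixed moment of the odd word give a line that closes
up and is close to the given one; hence it still crosses all sides in their interiors.\<close>

theorem odd_closed_line_stable:
  assumes z: "z \<in> obtuse_triangles" and W: "odd (length W)" "set W \<subseteq> {1, 2, 3}"
    and u: "norm (fst l) = 1" and closed: "fold (bounce z) W l = l" and hits: "hits z W l"
  shows "z \<in> interior (orbit_tile W)"
proof -
  have nz: "\<And>j. side_direction z j \<noteq> 0" using side_direction_neq_0[OF z] .
  obtain u0 c0 where l: "l = (u0, c0)" by fastforce
  have "(rotation_root z W)\<^sup>2 * cnj u0 = u0"
    using fst_fold_bounce[OF nz, of W u0 c0] closed W(1) by (simp add: l)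
  then have "(rotation_root z W)\<^sup>2 * (cnj u0 * u0) = u0\<^sup>2"
    by (metis mult.assoc power2_eq_square)
  moreover have "cnj u0 * u0 = 1"
    using unit_times_cnj[of u0] u by (simp add: l mult.commute)
  ultimately have "u0\<^sup>2 = (rotation_root z W)\<^sup>2" by (metis mult_1_right)
  then have "u0 = rotation_root z W \<or> u0 = - rotation_root z W" by (simp add: power2_eq_iff)
  \<comment> \<open>The sign picks the orientation of the axis that the given line has.\<close>
  then obtain \<epsilon> :: complex where \<epsilon>: "\<epsilon> = 1 \<or> \<epsilon> = -1" "u0 = \<epsilon> * rotation_root z W"
    by (cases "u0 = rotation_root z W") (use that[of 1] that[of "- 1"] in simp_all)
  define v where "v y = \<epsilon> * rotation_root y W" for y
  define f where "f y = (v y, snd (fold (bounce y) W (v y, 0)) / 2)" for y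
  have v_cont: "isCont v z"
    unfolding v_def by (rule isCont_mult[OF continuous_const isCont_rotation_root[OF nz]])
  have "isCont (\<lambda>y. fold (bounce y) W (v y, 0)) z"
    by (rule isCont_fold_bounce[OF continuous_Pair[OF v_cont continuous_const] nz])
  from isCont_divide[OF continuous_snd[OF this] continuous_const, of 2]
  have f_cont: "isCont f z"
    unfolding f_def by (intro continuous_Pair v_cont) simp
  have "snd (fold (bounce z) W (u0, 0)) = 2 * c0"
    using snd_fold_bounce[of z W u0 c0] closed W(1) by (simp add: l)
  then have f_z: "f z = l" by (simp add: f_def v_def l \<epsilon>(2))
  have f_closed: "fold (bounce y) W (f y) = f y" and f_norm: "norm (fst (f y)) = 1"
    if "y \<in> obtuse_triangles" for y
  proof -
    have nz: "\<And>j. side_direction y j \<noteq> 0" using side_direction_neq_0[OF that] .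
    have n1: "rotation_root y W * cnj (rotation_root y W) = 1"
      using norm_rotation_root[OF nz, of W] by (rule unit_times_cnj)
    have "fst (fold (bounce y) W (f y)) = (rotation_root y W)\<^sup>2 * cnj (v y)"
      unfolding f_def fst_fold_bounce[OF nz] using W(1) by simp
    also have "\<dots> = \<epsilon> * (rotation_root y W * (rotation_root y W * cnj (rotation_root y W)))"
      using \<epsilon>(1) by (auto simp: v_def power2_eq_square)
    finally have 1: "fst (fold (bounce y) W (f y)) = v y"
      unfolding n1 by (simp add: v_def)
    have 2: "snd (fold (bounce y) W (f y)) = snd (f y)"
      using snd_fold_bounce[of y W "v y" "snd (f y)"] W(1) by (simp add: f_def)
    have "v y = fst (f y)" by (simp add: f_def)
    with 1 2 show "fold (bounce y) W (f y) = f y" by (intro prod_eqI) simp_all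
    show "norm (fst (f y)) = 1"
      using \<epsilon>(1) norm_rotation_root[OF nz, of W] by (auto simp: f_def v_def norm_mult)
  qed
  have "\<forall>\<^sub>F y in nhds z. y \<in> obtuse_triangles"
    using open_obtuse_triangles z by (rule eventually_nhds_in_open)
  moreover have "\<forall>\<^sub>F y in nhds z. hits y W (f y)"
    using eventually_hits[OF f_cont nz] hits by (simp add: f_z)
  ultimately have "\<forall>\<^sub>F y in nhds z. y \<in> orbit_tile W"
  proof eventually_elim
    case (elim y)
    have "W \<noteq> []" using W(1) by auto
    from closed_line_in_orbit_tile[OF elim(1) this W(2) f_norm[OF elim(1)] f_closed[OF elim(1)] elim(2)]
    show ?case .
  qed
  then show ?thesis by (auto simp: eventually_nhds interior_def)
qed

section \<open>The path in the isosceles triangle\<close>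

text \<open>The line that leaves the base at the angle \<open>2jx\<close>, upwards and towards side 2 when this angle is small,
at distance \<open>\<rho>\<close> from vertex 1, which is the origin. For \<open>j = 0\<close> it is the horizontal line at height \<open>\<rho>\<close>,
traversed from right to left. With \<open>\<rho> = sin 2x * sin 2jx - \<sigma>\<close> it has distance \<open>\<sigma>\<close> from vertex 2.\<close>

definition ray :: "real \<Rightarrow> nat \<Rightarrow> real \<Rightarrow> complex \<times> real" where
  "ray x j \<rho> = (cis (pi - 2 * real j * x), - \<rho>)"

definition block :: "nat \<Rightarrow> nat list \<Rightarrow> nat list" where
  "block k w = concat (replicate k w)"

definition two_fans :: "nat \<Rightarrow> nat list" where
  "two_fans m = block m [2, 3] @ block m [1, 3]"

definition orbit_word :: "nat \<Rightarrow> nat \<Rightarrow> nat list" where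
  "orbit_word m k = [2, 3] @ block (Suc k) (two_fans m) @ [1]"

lemma block_simps: "block 0 w = []" "block (Suc k) w = w @ block k w"
  by (simp_all add: block_def)

lemma block_Suc_right: "block (Suc k) w = block k w @ w"
  by (induction k) (simp_all add: block_simps)

lemma odd_length_orbit_word: "odd (length (orbit_word m k))"
proof -
  have "length (block i w) = i * length w" for i w
    by (induction i) (simp_all add: block_simps)
  then show ?thesis by (simp add: orbit_word_def two_fans_def)
qed

lemma set_orbit_word: "set (orbit_word m k) \<subseteq> {1, 2, 3}"
  by (auto simp: orbit_word_def two_fans_def block_def)

lemma mirror_cis:
  assumes "r \<noteq> 0"
  shows "mirror (of_real r * cis a) (cis t) = cis (2 * a - t)"
proof -
  have "sgn (of_real r * cis a) = of_real (sgn r) * cis a"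
    using assms by (simp add: sgn_eq norm_mult sgn_if)
  then have "(sgn (of_real r * cis a))\<^sup>2 = (of_real (sgn r))\<^sup>2 * cis (2 * a)"
    by (simp add: power_mult_distrib Complex.DeMoivre)
  also have "(of_real (sgn r) :: complex)\<^sup>2 = 1"
    using assms by (simp add: sgn_if)
  finally have "mirror (of_real r * cis a) (cis t) = cis (2 * a) * cnj (cis t)"
    using assms by (subst mirror_eq_cnj) simp_all
  then show ?thesis by (simp only: cis_cnj cis_mult) simp
qed

context
  fixes x :: real
  assumes x: "0 < x" "x < pi / 4"
begin

text \<open>A line that leaves the base at the angle \<open>2jx\<close> meets the base at the distance
  \<open>\<rho> / s j\<close> from a base corner, where \<open>\<rho>\<close> is its distance to that corner.\<close>

abbreviation (input) "s j \<equiv> sin (2 * real j * x)"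

lemma sin_pos: "sin x > 0" "sin (2 * x) > 0" "cos x > 0"
  using x by (simp_all add: sin_gt_zero cos_gt_zero_pi)

lemma vertices:
  "vertex (x, x) (Suc 0) = 0" "vertex (x, x) 2 = of_real (sin (2 * x))" "vertex (x, x) 3 = of_real (sin x) * cis x"
  unfolding vertex_def prod.case mult_2 by simp_all

lemma directions:
  "side_direction (x, x) (Suc 0) = of_real (- sin x) * cis (- x)"
  "side_direction (x, x) 2 = of_real (- sin x) * cis x"
  "side_direction (x, x) 3 = of_real (sin (2 * x)) * cis 0"
  by (simp_all add: side_direction_def sides vertices complex_eq_iff sin_double)

lemma mirrors:
  "mirror (side_direction (x, x) (Suc 0)) (cis t) = cis (- 2 * x - t)"
  "mirror (side_direction (x, x) 2) (cis t) = cis (2 * x - t)"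
  "mirror (side_direction (x, x) 3) (cis t) = cis (- t)"
  using sin_pos mirror_cis[of "- sin x" "- x" t] mirror_cis[of "- sin x" x t]
    mirror_cis[of "sin (2 * x)" 0 t]
  unfolding directions by simp_all

lemma moments:
  "moment (cis t) (vertex (x, x) (Suc 0)) = 0"
  "moment (cis t) (vertex (x, x) 2) = - sin (2 * x) * sin t"
  "moment (cis t) (vertex (x, x) 3) = sin x * sin (x - t)"
  by (simp_all add: moment_def vertices sin_diff right_diff_distrib)

lemma bounce_2:
  "bounce (x, x) 2 (ray x j \<rho>) = (cis (2 * real (Suc j) * x - pi), \<rho>)"
proof -
  have a: "2 * x - (pi - 2 * real j * x) = 2 * real (Suc j) * x - pi"
    by (simp add: algebra_simps)
  have b: "moment (cis (pi - 2 * real j * x)) (vertex (x, x) 3)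
      + moment (cis (2 * real (Suc j) * x - pi)) (vertex (x, x) 3) = 0"
  proof -
    have "x - (2 * real (Suc j) * x - pi) = - (x - (pi - 2 * real j * x))"
      by (simp add: algebra_simps)
    then show ?thesis unfolding moments by (simp only: sin_minus)
  qed
  show ?thesis
    unfolding ray_def bounce_Pair mirrors a sides fst_conv b by simp
qed

lemma bounce_3: "bounce (x, x) 3 (cis t, c) = (cis (- t), - c)"
  by (simp add: bounce_Pair mirrors sides moments)

lemma bounce_1:
  "bounce (x, x) (Suc 0) (ray x (Suc j) (sin (2 * x) * s (Suc j) - \<sigma>))
     = (cis (2 * real j * x - pi), sin (2 * x) * s j - \<sigma>)"
proof -
  have a: "- 2 * x - (pi - 2 * real (Suc j) * x) = 2 * real j * x - pi"
    by (simp add: algebra_simps)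
  have b: "sin (2 * real j * x - pi) = - s j" "sin (pi - 2 * real (Suc j) * x) = s (Suc j)"
    by (simp_all add: sin_diff)
  show ?thesis
    unfolding ray_def bounce_Pair mirrors a sides fst_conv moments b by simp
qed

text \<open>A bounce off side 2 and one off the base, seen from vertex 1. The distance \<open>\<rho>\<close> to that vertex is kept and the
angle at the base grows by \<open>2x\<close>. The bounds on \<open>\<rho>\<close> say that the line passes to the correct side of
the apex and of vertex 2.\<close>

lemma fan_1_step:
  "fold (bounce (x, x)) [2, 3] (ray x j \<rho>) = ray x (Suc j) \<rho>"
  "hits (x, x) [2, 3] (ray x j \<rho>) \<longleftrightarrow>
     0 < \<rho> \<and> \<rho> < sin x * sin ((2 * real j + 1) * x) \<and> \<rho> < sin (2 * x) * s (Suc j)"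
proof -
  have "- (2 * real (Suc j) * x - pi) = pi - 2 * real (Suc j) * x" by simp
  then have b: "bounce (x, x) 3 (cis (2 * real (Suc j) * x - pi), \<rho>) = ray x (Suc j) \<rho>"
    unfolding bounce_3 ray_def by simp
  then show "fold (bounce (x, x)) [2, 3] (ray x j \<rho>) = ray x (Suc j) \<rho>"
    by (simp add: bounce_2 del: of_nat_Suc)
  have "x - (2 * real (Suc j) * x - pi) = pi - (2 * real j + 1) * x"
    by (simp add: algebra_simps)
  then have "sin (x - (2 * real (Suc j) * x - pi)) = sin ((2 * real j + 1) * x)"
    by (simp only: sin_pi_minus)
  then have "leaves (x, x) 2 (cis (2 * real (Suc j) * x - pi), \<rho>)
      \<longleftrightarrow> 0 < \<rho> \<and> \<rho> < sin x * sin ((2 * real j + 1) * x)"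
    unfolding leaves_def prod.case sides fst_conv snd_conv One_nat_def moments by simp
  moreover have "leaves (x, x) 3 (ray x (Suc j) \<rho>) \<longleftrightarrow> 0 < \<rho> \<and> \<rho> < sin (2 * x) * s (Suc j)"
    unfolding leaves_def ray_def prod.case sides fst_conv snd_conv One_nat_def moments
    by (auto simp del: of_nat_Suc)
  ultimately show "hits (x, x) [2, 3] (ray x j \<rho>) \<longleftrightarrow>
     0 < \<rho> \<and> \<rho> < sin x * sin ((2 * real j + 1) * x) \<and> \<rho> < sin (2 * x) * s (Suc j)"
    by (auto simp: bounce_2 b simp del: of_nat_Suc)
qed

lemma leaves_1:
  "leaves (x, x) (Suc 0) (cis (2 * real j * x - pi), sin (2 * x) * s j - \<sigma>) \<longleftrightarrow>
     0 < \<sigma> \<and> \<sigma> < sin x * sin ((2 * real j + 1) * x)"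
proof -
  have "x - (2 * real j * x - pi) = pi - (2 * real j * x - x)"
    by (simp add: algebra_simps)
  then have 1: "sin (x - (2 * real j * x - pi)) = sin (2 * real j * x - x)"
    by (simp only: sin_pi_minus)
  have "sin ((2 * real j + 1) * x) = sin (2 * real j * x + x)"
    by (simp add: algebra_simps)
  then have 2: "sin (2 * x) * s j - sin x * sin (2 * real j * x - x)
      = sin x * sin ((2 * real j + 1) * x)"
    unfolding sin_add sin_diff sin_double by (simp add: algebra_simps)
  have 3: "sin (2 * real j * x - pi) = - s j" by (simp add: sin_diff)
  show ?thesis
    unfolding leaves_def prod.case sides fst_conv snd_conv moments 1 3 2[symmetric] by auto
qed

text \<open>The mirror image: a bounce off side 1 and one off the base keep the distance \<open>\<sigma>\<close> to vertex 2
and lower the angle at the base by \<open>2x\<close>.\<close>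

lemma fan_2_step:
  "fold (bounce (x, x)) [1, 3] (ray x (Suc j) (sin (2 * x) * s (Suc j) - \<sigma>))
     = ray x j (sin (2 * x) * s j - \<sigma>)"
  "hits (x, x) [1, 3] (ray x (Suc j) (sin (2 * x) * s (Suc j) - \<sigma>)) \<longleftrightarrow>
     0 < \<sigma> \<and> \<sigma> < sin x * sin ((2 * real j + 1) * x) \<and> \<sigma> < sin (2 * x) * s j"
proof -
  have "- (2 * real j * x - pi) = pi - 2 * real j * x" by simp
  then have b: "bounce (x, x) 3 (cis (2 * real j * x - pi), c) = ray x j c" for c
    unfolding bounce_3 ray_def by simp
  then show "fold (bounce (x, x)) [1, 3] (ray x (Suc j) (sin (2 * x) * s (Suc j) - \<sigma>))
     = ray x j (sin (2 * x) * s j - \<sigma>)"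
    by (simp add: bounce_1 del: of_nat_Suc)
  have "leaves (x, x) 3 (ray x j (sin (2 * x) * s j - \<sigma>)) \<longleftrightarrow> 0 < \<sigma> \<and> \<sigma> < sin (2 * x) * s j"
    unfolding leaves_def ray_def prod.case sides fst_conv snd_conv One_nat_def moments
    by auto
  then show "hits (x, x) [1, 3] (ray x (Suc j) (sin (2 * x) * s (Suc j) - \<sigma>)) \<longleftrightarrow>
     0 < \<sigma> \<and> \<sigma> < sin x * sin ((2 * real j + 1) * x) \<and> \<sigma> < sin (2 * x) * s j"
    by (auto simp: bounce_1 b leaves_1 simp del: of_nat_Suc)
qed

lemma fan_1:
  assumes "0 < \<rho>"
    and "\<And>i. j \<le> i \<Longrightarrow> i < j + m \<Longrightarrow> \<rho> < sin x * sin ((2 * real i + 1) * x) \<and> \<rho> < sin (2 * x) * s (Suc i)"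
  shows "fold (bounce (x, x)) (block m [2, 3]) (ray x j \<rho>) = ray x (j + m) \<rho>
    \<and> hits (x, x) (block m [2, 3]) (ray x j \<rho>)"
  using assms(2)
proof (induction m arbitrary: j)
  case (Suc m)
  have 1: "hits (x, x) [2, 3] (ray x j \<rho>)"
    unfolding fan_1_step(2) using Suc.prems[of j] assms(1) by simp
  have "fold (bounce (x, x)) (block m [2, 3]) (ray x (Suc j) \<rho>) = ray x (Suc j + m) \<rho>
      \<and> hits (x, x) (block m [2, 3]) (ray x (Suc j) \<rho>)"
    by (rule Suc.IH) (rule Suc.prems; simp)
  then show ?case
    unfolding block_simps fold_append hits_append comp_apply fan_1_step(1)
    using 1 by (metis add_Suc_shift)
qed (simp add: block_simps)

lemma fan_2:
  assumes "0 < \<sigma>"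
    and "\<And>i. j \<le> i \<Longrightarrow> i < j + m \<Longrightarrow> \<sigma> < sin x * sin ((2 * real i + 1) * x) \<and> \<sigma> < sin (2 * x) * s i"
  shows "fold (bounce (x, x)) (block m [1, 3]) (ray x (j + m) (sin (2 * x) * s (j + m) - \<sigma>))
      = ray x j (sin (2 * x) * s j - \<sigma>)
    \<and> hits (x, x) (block m [1, 3]) (ray x (j + m) (sin (2 * x) * s (j + m) - \<sigma>))"
  using assms(2)
proof (induction m)
  case (Suc m)
  let ?r = "\<lambda>i. ray x i (sin (2 * x) * s i - \<sigma>)"
  have 1: "hits (x, x) [1, 3] (?r (Suc (j + m)))"
    unfolding fan_2_step(2) using Suc.prems[of "j + m"] assms(1) by simp
  have "fold (bounce (x, x)) (block m [1, 3]) (?r (j + m)) = ?r j \<and> hits (x, x) (block m [1, 3]) (?r (j + m))"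
    by (rule Suc.IH) (rule Suc.prems; simp)
  then show ?case
    unfolding block_simps fold_append hits_append comp_apply add_Suc_right fan_2_step(1)
    using 1 by blast
qed (simp add: block_simps)

lemma sin_ge_sin_end:
  assumes "pi - a \<le> t" "t \<le> a" "a \<le> pi"
  shows "sin a \<le> sin t"
proof -
  have "cos ((t + a) / 2) \<le> cos (pi / 2)"
    using assms by (intro cos_monotone_0_pi_le) auto
  moreover have "sin ((t - a) / 2) = - sin ((a - t) / 2)"
    by (simp add: minus_divide_left flip: sin_minus)
  moreover have "0 \<le> sin ((a - t) / 2)"
    using assms by (intro sin_ge_zero) auto
  ultimately have "0 \<le> 2 * sin ((t - a) / 2) * cos ((t + a) / 2)"
    by (intro mult_nonpos_nonpos) auto
  then have "0 \<le> sin t - sin a" unfolding sin_diff_sin .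
  then show ?thesis by simp
qed

text \<open>All the bounds of the two fans follow from those at the largest angles, since the sine on an interval
symmetric about \<open>\<pi>/2\<close> is smallest at its ends. For the legs this uses \<open>2(m+2)x > \<pi>\<close>. The bounds
at the base come from \<open>\<rho>\<close> and \<open>\<sigma>\<close> being positive with sum \<open>sin 2x * s (m+1)\<close>.\<close>

lemma double_fan:
  assumes m: "2 * real (Suc m) * x < pi" "pi < 2 * real (Suc (Suc m)) * x"
    and "0 < \<rho>" "0 < \<sigma>" "\<rho> + \<sigma> = sin (2 * x) * s (Suc m)"
    and "\<rho> < sin x * sin ((2 * real m + 1) * x)" "\<sigma> < sin x * sin ((2 * real m + 1) * x)"
  shows "fold (bounce (x, x)) (two_fans m) (ray x 1 \<rho>) = ray x 1 (sin (2 * x) * s 1 - \<sigma>)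
    \<and> hits (x, x) (two_fans m) (ray x 1 \<rho>)"
proof -
  have expand: "(2 * real i + 1) * x = 2 * (real i * x) + x" "2 * real i * x = 2 * (real i * x)"
    "real (Suc i) * x = real i * x + x" for i
    by (simp_all add: algebra_simps)
  note m' = m[unfolded expand]
  have leg: "sin x * sin ((2 * real m + 1) * x) \<le> sin x * sin ((2 * real i + 1) * x)"
    if i: "1 \<le> i" "i < 1 + m" for i
  proof -
    have "1 * x \<le> real i * x" "real i * x \<le> real m * x"
      using i x by (intro mult_right_mono; simp)+
    then have "sin ((2 * real m + 1) * x) \<le> sin ((2 * real i + 1) * x)"
      unfolding expand using m' x by (intro sin_ge_sin_end) argo+
    then show ?thesis using sin_pos by simp
  qed
  have base: "sin (2 * x) * s (Suc m) \<le> sin (2 * x) * s i"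
    if i: "1 \<le> i" "i \<le> Suc m" for i
  proof -
    have "1 * x \<le> real i * x" "real i * x \<le> real (Suc m) * x"
      using i x by (intro mult_right_mono; simp)+
    then have "s (Suc m) \<le> s i"
      unfolding expand using m' x by (intro sin_ge_sin_end) argo+
    then show ?thesis using sin_pos by simp
  qed
  have less: "\<rho> < sin (2 * x) * s (Suc m)" "\<sigma> < sin (2 * x) * s (Suc m)"
    using assms(3-5) by linarith+
  have 1: "fold (bounce (x, x)) (block m [2, 3]) (ray x 1 \<rho>) = ray x (1 + m) \<rho>
      \<and> hits (x, x) (block m [2, 3]) (ray x 1 \<rho>)"
  proof (rule fan_1[OF assms(3)])
    fix i assume i: "1 \<le> i" "i < 1 + m"
    show "\<rho> < sin x * sin ((2 * real i + 1) * x) \<and> \<rho> < sin (2 * x) * s (Suc i)"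
      using leg[OF i] base[of "Suc i"] less i assms(6) by fastforce
  qed
  have 2: "fold (bounce (x, x)) (block m [1, 3]) (ray x (1 + m) (sin (2 * x) * s (1 + m) - \<sigma>))
      = ray x 1 (sin (2 * x) * s 1 - \<sigma>)
    \<and> hits (x, x) (block m [1, 3]) (ray x (1 + m) (sin (2 * x) * s (1 + m) - \<sigma>))"
  proof (rule fan_2[OF assms(4)])
    fix i assume i: "1 \<le> i" "i < 1 + m"
    show "\<sigma> < sin x * sin ((2 * real i + 1) * x) \<and> \<sigma> < sin (2 * x) * s i"
      using leg[OF i] base[of i] less i assms(7) by fastforce
  qed
  have "sin (2 * x) * s (1 + m) - \<sigma> = \<rho>" using assms(5) by simp
  with 1 2 show ?thesis
    unfolding two_fans_def fold_append hits_append comp_apply by simp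
qed

text \<open>Before the pair of fans with index \<open>i\<close>, counted from 0, the distance to vertex 1 is \<open>y + i\<delta>\<close>, and at
its turning point the distance to vertex 2 is \<open>y + (k - i)\<delta>\<close>. So both stay between \<open>y\<close> and \<open>y + k\<delta>\<close>,
and the last fan ends at distance \<open>y\<close> from vertex 2. By this symmetry the final bounce off side 1
restores the horizontal line.\<close>

lemma orbit_word_closed_line:
  assumes m: "2 * real (Suc m) * x < pi" "pi < 2 * real (Suc (Suc m)) * x"
    and \<delta>: "\<delta> = sin (2 * x) * (s 1 - s (Suc m))" "0 \<le> \<delta>"
    and y: "2 * y + real k * \<delta> = sin (2 * x) * s (Suc m)" "0 < y" "y < sin x * sin x"
      "y + real k * \<delta> < sin x * sin ((2 * real m + 1) * x)"
  shows "fold (bounce (x, x)) (orbit_word m k) (ray x 0 y) = ray x 0 y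
    \<and> hits (x, x) (orbit_word m k) (ray x 0 y)"
proof -
  have blocks: "fold (bounce (x, x)) (block i (two_fans m)) (ray x 1 y) = ray x 1 (y + real i * \<delta>)
    \<and> hits (x, x) (block i (two_fans m)) (ray x 1 y)" if "i \<le> Suc k" for i
    using that
  proof (induction i)
    case (Suc i)
    define \<rho> where "\<rho> = y + real i * \<delta>"
    define \<sigma> where "\<sigma> = y + real (k - i) * \<delta>"
    have "real i * \<delta> \<le> real k * \<delta>" "real (k - i) * \<delta> \<le> real k * \<delta>"
      using Suc.prems \<delta>(2) by (intro mult_right_mono; simp)+
    moreover have "0 \<le> real i * \<delta>" "0 \<le> real (k - i) * \<delta>" using \<delta>(2) by simp_all
    moreover have sum: "\<rho> + \<sigma> = sin (2 * x) * s (Suc m)"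
      using Suc.prems unfolding y(1)[symmetric] \<rho>_def \<sigma>_def
      by (simp add: of_nat_diff algebra_simps)
    ultimately have "fold (bounce (x, x)) (two_fans m) (ray x 1 \<rho>) = ray x 1 (sin (2 * x) * s 1 - \<sigma>)
      \<and> hits (x, x) (two_fans m) (ray x 1 \<rho>)"
      using y(2,4) by (intro double_fan[OF m]) (auto simp: \<rho>_def \<sigma>_def)
    moreover have "sin (2 * x) * s 1 - \<sigma> = y + real (Suc i) * \<delta>"
    proof -
      have "sin (2 * x) * s 1 - \<sigma> = \<rho> + \<delta>"
        using sum unfolding \<delta>(1) right_diff_distrib by linarith
      then show ?thesis unfolding \<rho>_def by (simp add: distrib_right)
    qed
    moreover have "fold (bounce (x, x)) (block i (two_fans m)) (ray x 1 y) = ray x 1 \<rho>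
      \<and> hits (x, x) (block i (two_fans m)) (ray x 1 y)"
      using Suc unfolding \<rho>_def by simp
    ultimately show ?case
      unfolding block_Suc_right fold_append hits_append comp_apply by simp
  qed (simp add: block_simps)
  have sin_leg: "sin x * sin x \<le> sin (2 * x) * s (Suc 0)"
  proof -
    have "sin x \<le> sin (2 * x)" using x by (intro sin_monotone_2pi_le) auto
    then have "sin x * sin x \<le> sin (2 * x) * sin (2 * x)"
      using sin_pos by (intro mult_mono) auto
    then show ?thesis by simp
  qed
  have first: "hits (x, x) [2, 3] (ray x 0 y)"
    unfolding fan_1_step(2) using y(2,3) sin_leg by simp
  have last: "y + real (Suc k) * \<delta> = sin (2 * x) * s (Suc 0) - y"
    using y(1) unfolding \<delta>(1) by (simp add: algebra_simps)
  define r where "r = ray x (Suc 0) (sin (2 * x) * s (Suc 0) - y)"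
  have "cis (2 * real 0 * x - pi) = cis (pi - 2 * real 0 * x)"
    by (simp add: complex_eq_iff)
  then have ray_0: "(cis (2 * real 0 * x - pi), sin (2 * x) * s 0 - y) = ray x 0 y"
    unfolding ray_def by simp
  have close: "bounce (x, x) (Suc 0) r = ray x 0 y"
    unfolding r_def bounce_1 by (rule ray_0)
  have "leaves (x, x) (Suc 0) (ray x 0 y)"
    using leaves_1[of 0 y] y(2,3) unfolding ray_0 by simp
  moreover have "fold (bounce (x, x)) (block (Suc k) (two_fans m)) (ray x (Suc 0) y) = r"
    "hits (x, x) (block (Suc k) (two_fans m)) (ray x (Suc 0) y)"
    using blocks[of "Suc k"] unfolding r_def last by simp_all
  ultimately show ?thesis
    using first close
    unfolding orbit_word_def fold_append hits_append comp_apply fan_1_step(1) by simp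
qed

section \<open>Choosing the number of repetitions\<close>

lemma exists_multiple_between:
  fixes l u d :: real
  assumes "0 < d" "0 < u" "l < 0 \<or> d < u - l"
  shows "\<exists>k::nat. l < real k * d \<and> real k * d < u"
proof (cases "l < 0")
  case True
  then show ?thesis using assms(2) by (intro exI[of _ 0]) simp
next
  case False
  define k where "k = nat (\<lfloor>l / d\<rfloor> + 1)"
  have "real k = of_int \<lfloor>l / d\<rfloor> + 1"
    using False assms(1) by (simp add: k_def)
  then have "l / d < real k" "real k \<le> l / d + 1" by linarith+
  then have "l < real k * d" "real k * d \<le> l + d"
    using assms(1) by (simp_all add: field_simps)
  then show ?thesis using False assms(3) by (intro exI[of _ k]) linarith
qed

text \<open>With \<open>sin 2x = tan x (1 + cos 2x)\<close> the interval exceeds the step \<open>D = sin 2x - sin \<beta>\<close> by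
\<open>tan x (cos \<beta> - cos 2x)\<close> if it ends at \<open>cos \<beta> tan x\<close>. If it ends at \<open>sin \<beta>\<close>, its length is \<open>tan x\<close>, and
\<open>D \<le> sin 2x - tan x = tan x cos 2x < tan x\<close> as soon as the left end is nonnegative.\<close>

lemma exists_repetition_number:
  assumes \<beta>: "0 < \<beta>" "\<beta> < 2 * x"
  shows "\<exists>k::nat. sin \<beta> - tan x < real k * (sin (2 * x) - sin \<beta>)
    \<and> real k * (sin (2 * x) - sin \<beta>) < min (sin \<beta>) (cos \<beta> * tan x)"
proof (rule exists_multiple_between)
  have b: "sin \<beta> > 0" "cos \<beta> > 0" "tan x > 0"
    using \<beta> x by (auto intro!: sin_gt_zero cos_gt_zero_pi tan_gt_zero)
  show "0 < sin (2 * x) - sin \<beta>"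
    using sin_monotone_2pi[of \<beta> "2 * x"] \<beta> x by simp
  show "0 < min (sin \<beta>) (cos \<beta> * tan x)" using b by simp
  have "sin (2 * x) = 2 * sin x * cos x" "cos (2 * x) = 2 * (cos x)\<^sup>2 - 1"
    by (simp_all add: sin_double cos_double_cos)
  then have sin2: "sin (2 * x) = tan x * (1 + cos (2 * x))"
    using sin_pos by (simp add: tan_def power2_eq_square)
  have c: "cos (2 * x) < cos \<beta>" "cos (2 * x) < 1"
    using cos_monotone_0_pi[of \<beta> "2 * x"] cos_monotone_0_pi[of 0 "2 * x"] \<beta> x by simp_all
  show "sin \<beta> - tan x < 0 \<or>
      sin (2 * x) - sin \<beta> < min (sin \<beta>) (cos \<beta> * tan x) - (sin \<beta> - tan x)"
  proof (cases "sin \<beta> < tan x")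
    case False
    have "tan x * cos (2 * x) < tan x * 1" "tan x * cos (2 * x) < tan x * cos \<beta>"
      using b c by (simp_all only: mult_less_cancel_left_pos)
    then show ?thesis
      using False unfolding sin2 by (auto simp: algebra_simps min_def)
  qed simp
qed

text \<open>Solving the closing condition for the height gives \<open>y = sin x cos x (sin \<beta> - kD)\<close>, and after division by
\<open>sin x cos x\<close> the three bounds on \<open>y\<close> become those of \<open>exists_repetition_number\<close>.\<close>

lemma isosceles_point_in_interior:
  assumes m: "2 * real (Suc m) * x < pi" "pi < 2 * real (Suc (Suc m)) * x"
  shows "\<exists>k. (x, x) \<in> interior (orbit_tile (orbit_word m k))"
proof -
  define \<beta> where "\<beta> = pi - 2 * real (Suc m) * x"
  have \<beta>: "0 < \<beta>" "\<beta> < 2 * x" using m by (auto simp: \<beta>_def algebra_simps)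
  obtain k :: nat where k: "sin \<beta> - tan x < real k * (sin (2 * x) - sin \<beta>)"
    "real k * (sin (2 * x) - sin \<beta>) < sin \<beta>"
    "real k * (sin (2 * x) - sin \<beta>) < cos \<beta> * tan x"
    using exists_repetition_number[OF \<beta>] by auto
  define e where "e = real k * (sin (2 * x) - sin \<beta>)"
  define c where "c = sin x * cos x"
  have c: "c > 0" "sin (2 * x) = 2 * c" "c * tan x = sin x * sin x"
    using sin_pos by (simp_all add: c_def sin_double tan_def)
  define y where "y = c * (sin \<beta> - e)"
  define \<delta> where "\<delta> = sin (2 * x) * (s 1 - s (Suc m))"
  have "s (Suc m) = sin \<beta>" unfolding \<beta>_def sin_pi_minus ..
  moreover have "s 1 = sin (2 * x)" by simp
  ultimately have s: "s (Suc m) = sin \<beta>" "s 1 = sin (2 * x)" .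
  have k\<delta>: "real k * \<delta> = 2 * c * e" unfolding \<delta>_def s e_def c(2)[symmetric] by simp
  have "sin \<beta> < sin (2 * x)"
    using sin_monotone_2pi[of \<beta> "2 * x"] \<beta> x by simp
  then have \<delta>0: "0 \<le> \<delta>" using sin_pos unfolding \<delta>_def s by simp
  have y1: "2 * y + real k * \<delta> = sin (2 * x) * s (Suc m)"
    unfolding k\<delta> s c(2) y_def by (simp add: algebra_simps)
  have y2: "0 < y" using k(2) c(1) by (simp add: y_def e_def)
  have "c * (sin \<beta> - e) < c * tan x"
    using k(1) c(1) by (simp add: e_def)
  then have y3: "y < sin x * sin x" unfolding y_def c(3) .
  have "(2 * real m + 1) * x = pi - (\<beta> + x)" by (simp add: \<beta>_def algebra_simps)
  then have "sin ((2 * real m + 1) * x) = sin (\<beta> + x)" by (simp only: sin_pi_minus)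
  then have "sin x * sin ((2 * real m + 1) * x) = c * sin \<beta> + c * (cos \<beta> * tan x)"
    using sin_pos by (simp add: sin_add c_def tan_def algebra_simps)
  moreover have "c * e < c * (cos \<beta> * tan x)" using k(3) c(1) by (simp add: e_def)
  ultimately have y4: "y + real k * \<delta> < sin x * sin ((2 * real m + 1) * x)"
    unfolding k\<delta> y_def by (simp add: algebra_simps)
  note line = orbit_word_closed_line[OF m \<delta>_def \<delta>0 y1 y2 y3 y4]
  have "(x, x) \<in> interior (orbit_tile (orbit_word m k))"
  proof (rule odd_closed_line_stable)
    show "(x, x) \<in> obtuse_triangles" using x by (simp add: obtuse_triangles_def)
    show "norm (fst (ray x 0 y)) = 1" by (simp add: ray_def)
  qed (use line odd_length_orbit_word set_orbit_word in auto)
  then show ?thesis ..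
qed

end

theorem theorem1p2:
  fixes x :: real
  assumes "0 < x" and "x < pi / 4"
    and "\<forall>n\<ge>3. (x, x) \<noteq> V n"
  shows "\<exists>W :: nat list. W \<noteq> [] \<and> set W \<subseteq> {1, 2, 3} \<and> (x, x) \<in> interior (orbit_tile W)"
proof -
  define n where "n = nat \<lfloor>pi / (2 * x)\<rfloor>"
  have "2 < pi / (2 * x)" using assms(1,2) by (simp add: field_simps)
  then have n: "2 \<le> n" "real n \<le> pi / (2 * x)" "pi / (2 * x) < real n + 1"
    unfolding n_def by linarith+
  have "real n \<noteq> pi / (2 * x)"
  proof
    assume "real n = pi / (2 * x)"
    then have eq: "x = pi / (2 * real n)" using assms(1) n(1) by (simp add: field_simps)
    then have "n \<noteq> 2" using assms(2) by auto
    then have "3 \<le> n" using n(1) by simp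
    moreover have "(x, x) = V n" unfolding V_def using eq by simp
    ultimately show False using assms(3) by blast
  qed
  with n(2) have "real n < pi / (2 * x)" by simp
  moreover obtain m where m: "n = Suc m" using n(1) by (cases n) auto
  ultimately have "2 * real (Suc m) * x < pi" "pi < 2 * real (Suc (Suc m)) * x"
    using n(3) assms(1) by (simp_all add: field_simps)
  then obtain k where "(x, x) \<in> interior (orbit_tile (orbit_word m k))"
    using isosceles_point_in_interior[OF assms(1,2)] by blast
  moreover have "orbit_word m k \<noteq> []" using odd_length_orbit_word[of m k] by auto
  ultimately show ?thesis using set_orbit_word by blast
qed

end
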